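(* Let $Y$ be the complete graph on $n$ vertices and let $Y^f$ be a connected cyclic 2ev-cover of $Y$. Then $Y^f$ is a drackn, i.e. a distance-regular antipodal cover of the complete graph $K_n$.
   Context: All graphs are finite, simple and undirected. Covers: let $Y=(V,E)$ be a connected graph and $G$ a permutation group on $R=\{1,\dots,r\}$. A symmetric arc function is a function $f:V\times V\to G\cup\{0\}$ such that $f(u,v)=0$ if and only if $\{u,v\}\notin E$, and $f(u,v)=f(v,u)^{-1}$ whenever $f(u,v)\in G$. The cover $Y^f$ (of index $r$, or $r$-fold) is the graph with vertex set $V\times R$ in which $(v,j)$ is adjacent to $(u,k)$ exactly when $v$ is adjacent to $u$ in $Y$ and $f(u,v)j=k$. The function $f$ is normalized if $f(u,v)=\mathrm{id}$ for all edges $\{u,v\}$ of some spanning tree of $Y$. Denote by $\langle f\rangle$ the subgroup of $\mathrm{Sym}(r)$ generated by the (non-zero) values of $f$. Standing assumptions: $f$ is normalized and $\langle f\rangle$ acts regularly (i.e. simply transitively) on $\{1,\dots,r\}$. The cover is called cyclic if $\langle f\rangle$ is a cyclic group. Two-eigenvalue cover (2ev-cover): $\mathrm{Spec}(A)$ denotes the spectrum of $A$ as a multiset, and $A(\cdot)$ the adjacency matrix. One has $\mathrm{Spec}(A(Y))\subseteq\mathrm{Spec}(A(Y^f))$ as multisets, and $Y^f$ is a 2ev-cover of $Y$ if the multiset difference $\mathrm{Spec}(A(Y^f))\setminus\mathrm{Spec}(A(Y))$ has exactly two distinct elements. Distance-regular has its standard meaning: a connected graph of diameter $d$ such that for vertices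 $v,w$ at distance $i$, the numbers $b_i$ and $c_i$ of neighbours of $w$ at distance $i+1$, respectively $i-1$, from $v$ depend only on $i$. A graph of diameter $d$ is antipodal if the relation "equal or at distance $d$" is an equivalence relation on its vertices. The antipodal quotient of an antipodal distance-regular graph $X$ is the graph whose vertices are the antipodal classes (the classes of this relation), two distinct classes being adjacent if some edge of $X$ has one end in each. A drackn (distance-regular antipodal cover of $K_n$) is an antipodal distance-regular graph $X$ that is a cover of its antipodal quotient, this quotient being the complete graph $K_n$. *)

theory Defs
  imports
    "Graph_Theory.Graph_Theory"
    "Jordan_Normal_Form.Char_Poly"
    "HOL-Algebra.Sym_Groups"
    "HOL-Algebra.Elementary_Groups"
begin

text \<open>
  A finite simple undirected graph is a \<open>pair_graph\<close>: a finite, loop-free, symmetric set of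
  ordered pairs over a finite vertex set.
\<close>

section \<open>Covers\<close>

text \<open>
  The permutation group \<open>G\<close> on \<open>{1..r}\<close> is a subgroup of \<^term>\<open>sym_group r\<close>, and \<open>None\<close>
  plays the role of the extra value 0 of an arc function.
\<close>

definition symmetric_arc_function ::
  "'v pair_pre_digraph \<Rightarrow> nat \<Rightarrow> (nat \<Rightarrow> nat) set \<Rightarrow> ('v \<Rightarrow> 'v \<Rightarrow> (nat \<Rightarrow> nat) option) \<Rightarrow> bool"
where
  "symmetric_arc_function Y r G f \<longleftrightarrow>
     subgroup G (sym_group r) \<and>
     (\<forall>u\<in>pverts Y. \<forall>v\<in>pverts Y.
        (f u v = None \<longleftrightarrow> (u, v) \<notin> parcs Y) \<and>
        (\<forall>g. f u v = Some g \<longrightarrow> g \<in> G \<and> f v u = Some (inv\<^bsub>sym_group r\<^esub> g)))"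

definition cover ::
  "'v pair_pre_digraph \<Rightarrow> nat \<Rightarrow> ('v \<Rightarrow> 'v \<Rightarrow> (nat \<Rightarrow> nat) option) \<Rightarrow> ('v \<times> nat) pair_pre_digraph"
where
  "cover Y r f =
     \<lparr> pverts = pverts Y \<times> {1..r},
       parcs = {((v, j), (u, k)) | v j u k.
                  (v, u) \<in> parcs Y \<and> j \<in> {1..r} \<and> k \<in> {1..r} \<and>
                  (\<exists>g. f u v = Some g \<and> g j = k)} \<rparr>"

text \<open>
  The predicates \<^const>\<open>tree\<close> and \<^const>\<open>spanning_tree\<close> of the library concern directed cycles, so
  that an undirected edge \<open>{a, b}\<close>, that is, the walk \<open>a, b, a\<close>, already is a cycle. An undirected
  cycle is a directed one of length at least 3.
\<close>

definition undirected_spanning_tree :: "'v pair_pre_digraph \<Rightarrow> 'v pair_pre_digraph \<Rightarrow> bool" where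
  "undirected_spanning_tree T Y \<longleftrightarrow>
     pair_graph T \<and> spanning (with_proj T) (with_proj Y) \<and>
     Digraph_Component.connected (with_proj T) \<and>
     \<not> (\<exists>p. pre_digraph.cycle (with_proj T) p \<and> 3 \<le> length p)"

definition normalized :: "'v pair_pre_digraph \<Rightarrow> ('v \<Rightarrow> 'v \<Rightarrow> (nat \<Rightarrow> nat) option) \<Rightarrow> bool" where
  "normalized Y f \<longleftrightarrow>
     (\<exists>T. undirected_spanning_tree T Y \<and> (\<forall>(u, v)\<in>parcs T. f u v = Some id))"

definition arc_group ::
  "'v pair_pre_digraph \<Rightarrow> nat \<Rightarrow> ('v \<Rightarrow> 'v \<Rightarrow> (nat \<Rightarrow> nat) option) \<Rightarrow> (nat \<Rightarrow> nat) monoid"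
where
  "arc_group Y r f =
     subgroup_generated (sym_group r) {g. \<exists>u\<in>pverts Y. \<exists>v\<in>pverts Y. f u v = Some g}"

definition acts_regularly :: "(nat \<Rightarrow> nat) monoid \<Rightarrow> nat \<Rightarrow> bool" where
  "acts_regularly H r \<longleftrightarrow> (\<forall>i\<in>{1..r}. \<forall>j\<in>{1..r}. \<exists>!g. g \<in> carrier H \<and> g i = j)"


section \<open>Spectra\<close>

text \<open>
  Matrices are indexed by natural numbers, so an adjacency matrix depends on an enumeration of the
  vertices. Different enumerations give matrices that are similar via a permutation matrix, and
  hence the same spectrum; \<open>spec\<close> uses an arbitrary one. The matrix is taken over the complex
  numbers, where the characteristic polynomial splits.
\<close>

definition adjacency_mat :: "'v pair_pre_digraph \<Rightarrow> 'v list \<Rightarrow> complex mat" where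
  "adjacency_mat X vs =
     mat (length vs) (length vs) (\<lambda>(i, j). if (vs ! i, vs ! j) \<in> parcs X then 1 else 0)"

definition spec :: "'v pair_pre_digraph \<Rightarrow> complex multiset" where
  "spec X =
     proots (char_poly (adjacency_mat X (SOME vs. distinct vs \<and> set vs = pverts X)))"

definition two_ev_cover ::
  "'v pair_pre_digraph \<Rightarrow> nat \<Rightarrow> ('v \<Rightarrow> 'v \<Rightarrow> (nat \<Rightarrow> nat) option) \<Rightarrow> bool"
where
  "two_ev_cover Y r f \<longleftrightarrow> card (set_mset (spec (cover Y r f) - spec Y)) = 2"


section \<open>Distance-regular antipodal covers\<close>

text \<open>The following two notions are only used for connected graphs.\<close>

definition distance :: "'v pair_pre_digraph \<Rightarrow> 'v \<Rightarrow> 'v \<Rightarrow> nat" where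
  "distance X v w = (LEAST k. \<exists>p. pre_digraph.awalk (with_proj X) v p w \<and> length p = k)"

definition diam :: "'v pair_pre_digraph \<Rightarrow> nat" where
  "diam X = Max {distance X v w | v w. v \<in> pverts X \<and> w \<in> pverts X}"

definition distance_regular :: "'v pair_pre_digraph \<Rightarrow> bool" where
  "distance_regular X \<longleftrightarrow>
     pair_graph X \<and> Digraph_Component.connected (with_proj X) \<and>
     (\<exists>b c :: nat \<Rightarrow> nat. \<forall>v\<in>pverts X. \<forall>w\<in>pverts X. \<forall>i. distance X v w = i \<longrightarrow>
        card {x. (w, x) \<in> parcs X \<and> distance X v x = i + 1} = b i \<and>
        card {x. (w, x) \<in> parcs X \<and> distance X v x + 1 = i} = c i)"

definition antipodal_rel :: "'v pair_pre_digraph \<Rightarrow> 'v rel" where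
  "antipodal_rel X =
     {(v, w). v \<in> pverts X \<and> w \<in> pverts X \<and> (v = w \<or> distance X v w = diam X)}"

definition antipodal :: "'v pair_pre_digraph \<Rightarrow> bool" where
  "antipodal X \<longleftrightarrow> equiv (pverts X) (antipodal_rel X)"

definition antipodal_quotient :: "'v pair_pre_digraph \<Rightarrow> 'v set pair_pre_digraph" where
  "antipodal_quotient X =
     \<lparr> pverts = pverts X // antipodal_rel X,
       parcs = {(P, Q). P \<in> pverts X // antipodal_rel X \<and> Q \<in> pverts X // antipodal_rel X \<and>
                  P \<noteq> Q \<and> (\<exists>x\<in>P. \<exists>y\<in>Q. (x, y) \<in> parcs X)} \<rparr>"

text \<open>
  \<open>X\<close> is a cover of \<open>Z\<close> with projection \<open>\<pi>\<close>: up to isomorphism, \<open>X\<close> is the cover of \<open>Z\<close> given by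
  some symmetric arc function, where \<open>\<pi>\<close> corresponds to the projection \<open>(z, j) \<mapsto> z\<close>.
\<close>

definition is_cover_via ::
  "('x \<Rightarrow> 'z) \<Rightarrow> 'x pair_pre_digraph \<Rightarrow> 'z pair_pre_digraph \<Rightarrow> bool"
where
  "is_cover_via \<pi> X Z \<longleftrightarrow>
     pair_graph Z \<and> Digraph_Component.connected (with_proj Z) \<and>
     (\<exists>r G g h. symmetric_arc_function Z r G g \<and>
        pre_digraph.digraph_isomorphism (with_proj X) h \<and>
        with_proj (cover Z r g) = app_iso h (with_proj X) \<and>
        (\<forall>x\<in>pverts X. fst (iso_verts h x) = \<pi> x))"

definition drackn :: "nat \<Rightarrow> 'v pair_pre_digraph \<Rightarrow> bool" where
  "drackn n X \<longleftrightarrow>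
     distance_regular X \<and> antipodal X \<and>
     complete_digraph n (with_proj (antipodal_quotient X)) \<and>
     is_cover_via (\<lambda>x. antipodal_rel X `` {x}) X (antipodal_quotient X)"

end

theory Submission
  imports Defs "Jordan_Normal_Form.Schur_Decomposition"
begin

text \<open>
  Let \<open>A\<close> and \<open>B\<close> be the adjacency matrices of the cover and of \<open>Y\<close>, let \<open>\<theta>, \<tau>\<close> be the two new
  eigenvalues and \<open>p(x) = (x - \<theta>)(x - \<tau>) = x\<^sup>2 - a x + b\<close>. Comparing the traces of \<open>p(A)\<^sup>2\<close> and \<open>p(B)\<^sup>2\<close>
  eigenvalue by eigenvalue, the squared entries of \<open>p(A)\<close> sum to at most those of \<open>p(B)\<close>. But each row of a fibre
  block of \<open>p(A)\<close> sums to the corresponding entry of \<open>p(B)\<close>, so Cauchy and Schwarz forces every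
  entry of \<open>p(A)\<close> to be \<open>1/r\<close> times that entry of \<open>p(B)\<close>.

  For \<open>Y = K\<^sub>n\<close> this says that two vertices of distinct fibres have \<open>a + c\<close> or \<open>c\<close> common
  neighbours, according to whether they are adjacent, for a constant \<open>c\<close>. Connectedness gives \<open>c \<noteq> 0\<close>, and
  all distances and intersection numbers can be read off; the fibres are the antipodal classes.
\<close>

section \<open>Sums over eigenvalues\<close>

text \<open>Keeping the same \<open>P\<close> and \<open>Q\<close> lets a single conjugation carry
  every polynomial in a matrix to the same polynomial in its triangular form.\<close>

lemma similar_mat_wit_add:
  assumes "similar_mat_wit A B P Q" "similar_mat_wit A' B' P Q"
  shows "similar_mat_wit (A + A') (B + B') P Q"
proof -
  define n where "n = dim_row A"
  note 1 = similar_mat_witD[OF n_def assms(1)]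
  have "dim_row A' = n"
    using 1(6) similar_mat_witD(6)[OF refl assms(2)] by (metis carrier_matD(1))
  note 2 = similar_mat_witD[OF this[symmetric] assms(2)]
  show ?thesis
  proof (rule similar_mat_witI)
    show "A + A' = P * (B + B') * Q"
      unfolding 1(3) 2(3) using 1(4-7) 2(5)
      by (simp add: mult_add_distrib_mat[of P n n B n B'] add_mult_distrib_mat[of _ n n _ Q n])
  qed (use 1 2 in auto)
qed

lemma similar_mat_wit_mult:
  assumes "similar_mat_wit A B P Q" "similar_mat_wit A' B' P Q"
  shows "similar_mat_wit (A * A') (B * B') P Q"
proof -
  define n where "n = dim_row A"
  note 1 = similar_mat_witD[OF n_def assms(1)]
  have "dim_row A' = n"
    using 1(6) similar_mat_witD(6)[OF refl assms(2)] by (metis carrier_matD(1))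
  note 2 = similar_mat_witD[OF this[symmetric] assms(2)]
  show ?thesis
  proof (rule similar_mat_witI)
    note [simp] = 1(4-7) 2(5)
    have "A * A' = P * B * Q * (P * B' * Q)" unfolding 1(3) 2(3) ..
    also have "\<dots> = P * B * (Q * P) * (B' * Q)"
      by (simp add: assoc_mult_mat[of _ n n _ n _ n] mult_carrier_mat[of _ n n _ n])
    also have "\<dots> = P * (B * B') * Q"
      by (simp add: 1(1,2) assoc_mult_mat[of _ n n _ n _ n] mult_carrier_mat[of _ n n _ n]
          left_mult_one_mat[of _ n n])
    finally show "A * A' = P * (B * B') * Q" .
  qed (use 1 2 in auto)
qed

lemma similar_mat_wit_one:
  assumes "similar_mat_wit A B P Q" "A \<in> carrier_mat n n"
  shows "similar_mat_wit (1\<^sub>m n) (1\<^sub>m n) P Q"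
  using similar_mat_witD2[OF assms(2,1)] by (intro similar_mat_witI[of _ _ n]) auto

section \<open>Triangular matrices and traces\<close>

lemma upper_triangular_mult:
  fixes A B :: "'a :: comm_ring_1 mat"
  assumes "A \<in> carrier_mat n n" "B \<in> carrier_mat n n" "upper_triangular A" "upper_triangular B"
  shows "upper_triangular (A * B)" "i < n \<Longrightarrow> (A * B) $$ (i, i) = A $$ (i, i) * B $$ (i, i)"
proof -
  \<comment> \<open>If k < i, the factor from \<open>A\<close> lies below the diagonal. Otherwise k
    \<ge> i \<ge> j, not both with equality, so the factor from \<open>B\<close> does. Only k = i =
    j survives, which gives both claims.\<close>
  have zero: "A $$ (i, k) * B $$ (k, j) = 0" if "i < n" "k < n" "k \<noteq> i \<or> k \<noteq> j" "j \<le> i" for i j k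
  proof (cases "k < i")
    case True
    then show ?thesis using upper_triangularD[OF assms(3) True] that assms by simp
  next
    case False
    then have "j < k" using that by auto
    then show ?thesis using upper_triangularD[OF assms(4) \<open>j < k\<close>] that assms by simp
  qed
  have entry: "(A * B) $$ (i, j) = (\<Sum>k<n. A $$ (i, k) * B $$ (k, j))" if "i < n" "j < n" for i j
    using that assms by (auto simp: scalar_prod_def lessThan_atLeast0)
  show "upper_triangular (A * B)"
  proof
    fix i j assume "j < i" "i < dim_row (A * B)"
    with assms show "(A * B) $$ (i, j) = 0"
      by (subst entry) (auto intro!: sum.neutral zero)
  qed
  show "(A * B) $$ (i, i) = A $$ (i, i) * B $$ (i, i)" if "i < n"
  proof -
    have "(\<Sum>k<n. A $$ (i, k) * B $$ (k, i)) = (\<Sum>k\<in>{i}. A $$ (i, k) * B $$ (k, i))"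
      using that by (intro sum.mono_neutral_right) (auto intro: zero)
    then show ?thesis using that by (simp add: entry)
  qed
qed

lemma trace_mult_commute:
  fixes A B :: "'a :: comm_semiring_0 mat"
  assumes "A \<in> carrier_mat n m" "B \<in> carrier_mat m n"
  shows "(\<Sum>i<n. (A * B) $$ (i, i)) = (\<Sum>i<m. (B * A) $$ (i, i))"
proof -
  have "(\<Sum>i<n. (A * B) $$ (i, i)) = (\<Sum>i<n. \<Sum>k<m. A $$ (i, k) * B $$ (k, i))"
    using assms by (intro sum.cong) (auto simp: scalar_prod_def lessThan_atLeast0)
  also have "\<dots> = (\<Sum>k<m. \<Sum>i<n. B $$ (k, i) * A $$ (i, k))"
    by (subst sum.swap) (simp add: mult.commute)
  also have "\<dots> = (\<Sum>i<m. (B * A) $$ (i, i))"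
    using assms by (intro sum.cong) (auto simp: scalar_prod_def lessThan_atLeast0)
  finally show ?thesis .
qed

lemma trace_similar:
  fixes A B :: "'a :: comm_ring_1 mat"
  assumes "similar_mat_wit A B P Q" "A \<in> carrier_mat n n"
  shows "(\<Sum>i<n. A $$ (i, i)) = (\<Sum>i<n. B $$ (i, i))"
proof -
  note 1 = similar_mat_witD2[OF assms(2,1)]
  have "(\<Sum>i<n. A $$ (i, i)) = (\<Sum>i<n. (P * B * Q) $$ (i, i))" unfolding 1(3) ..
  also have "\<dots> = (\<Sum>i<n. (Q * (P * B)) $$ (i, i))"
    by (rule trace_mult_commute) (use 1 in auto)
  also have "Q * (P * B) = B"
    using 1 by (simp flip: assoc_mult_mat[of Q n n P n B n])
  finally show ?thesis .
qed

text \<open>In a Schur form the diagonal lists the eigenvalues with multiplicity, and on triangular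
  matrices a polynomial acts on the diagonal entry by entry. The trace does not change under
  similarity.\<close>

lemma sum_eigenvalues_quadratic_square:
  fixes A :: "complex mat"
  assumes A: "A \<in> carrier_mat n n"
    and N: "N = A * A + ((-a) \<cdot>\<^sub>m A + b \<cdot>\<^sub>m 1\<^sub>m n)"
  shows "(\<Sum>x\<in>#proots (char_poly A). (x\<^sup>2 - a * x + b)\<^sup>2) = (\<Sum>i<n. (N * N) $$ (i, i))"
proof -
  obtain es where es: "char_poly A = (\<Prod>e\<leftarrow>es. [:- e, 1:])"
    using char_poly_factorized[OF A] by blast
  have roots: "proots (char_poly A) = mset es"
  proof -
    have "proots (\<Prod>e\<leftarrow>es. [:- e, 1:]) = mset es"
    proof (induction es)
      case (Cons e es)
      have "(\<Prod>e\<leftarrow>es. [:- e, 1:]) \<noteq> 0" by (auto simp: prod_list_zero_iff)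
      then have "proots ([:- e, 1:] * (\<Prod>e\<leftarrow>es. [:- e, 1:])) = {#e#} + mset es"
        by (subst proots_mult) (auto simp: Cons)
      then show ?case by simp
    qed simp
    then show ?thesis by (simp add: es)
  qed
  obtain B P Q where "schur_decomposition A es = (B, P, Q)" by (metis prod_cases3)
  from schur_decomposition[OF A es this]
  have sim: "similar_mat_wit A B P Q" and ut: "upper_triangular B" and diag: "diag_mat B = es"
    by auto
  have B: "B \<in> carrier_mat n n" using similar_mat_witD2[OF A sim] by auto
  define M where "M = B * B + ((-a) \<cdot>\<^sub>m B + b \<cdot>\<^sub>m 1\<^sub>m n)"
  have M: "M \<in> carrier_mat n n" using B by (auto simp: M_def)
  have simN: "similar_mat_wit N M P Q"
    unfolding N M_def
    by (intro similar_mat_wit_add similar_mat_wit_mult similar_mat_wit_smult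
        similar_mat_wit_one[OF sim A] sim)
  have utM: "upper_triangular M" 
    using upper_triangular_mult(1)[OF B B ut ut] ut B
    by (auto simp: M_def upper_triangular_def)
  have diagM: "M $$ (i, i) = (B $$ (i, i))\<^sup>2 - a * B $$ (i, i) + b" if "i < n" for i
    using upper_triangular_mult(2)[OF B B ut ut that] B that
    by (simp add: M_def power2_eq_square)
  have "N * N \<in> carrier_mat n n" using A by (auto simp: N)
  then have "(\<Sum>i<n. (N * N) $$ (i, i)) = (\<Sum>i<n. (M * M) $$ (i, i))"
    by (rule trace_similar[OF similar_mat_wit_mult[OF simN simN]])
  also have "\<dots> = (\<Sum>i<n. ((B $$ (i, i))\<^sup>2 - a * B $$ (i, i) + b)\<^sup>2)"
    by (intro sum.cong refl)
      (simp add: upper_triangular_mult(2)[OF M M utM utM] diagM power2_eq_square)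
  also have "\<dots> = (\<Sum>x\<leftarrow>diag_mat B. (x\<^sup>2 - a * x + b)\<^sup>2)"
    using B by (simp add: diag_mat_def comp_def interv_sum_list_conv_sum_set_nat lessThan_atLeast0)
  finally show ?thesis unfolding roots diag by (simp add: sum_mset_sum_list flip: mset_map)
qed

text \<open>For an eigenvector v the number s = v* A v equals its own conjugate because A is real
  and symmetric, and it also equals k times the positive real squared norm of v.\<close>

lemma eigenvalue_real_symmetric:
  fixes A :: "complex mat"
  assumes A: "A \<in> carrier_mat n n" and "eigenvalue A k"
    and sym: "\<And>i j. i < n \<Longrightarrow> j < n \<Longrightarrow> A $$ (i, j) = A $$ (j, i) \<and> A $$ (i, j) \<in> \<real>"
  shows "k \<in> \<real>"
proof -
  obtain v where v: "v \<in> carrier_vec n" "v \<noteq> 0\<^sub>v n" "A *\<^sub>v v = k \<cdot>\<^sub>v v"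
    using assms(2) A unfolding eigenvalue_def eigenvector_def by auto
  have row: "(\<Sum>j<n. A $$ (i, j) * v $ j) = k * v $ i" if "i < n" for i
  proof -
    have "(A *\<^sub>v v) $ i = (\<Sum>j<n. A $$ (i, j) * v $ j)"
      using that A v(1) by (simp add: scalar_prod_def lessThan_atLeast0)
    then show ?thesis using v that by simp
  qed
  define s where "s = (\<Sum>i<n. \<Sum>j<n. cnj (v $ i) * (A $$ (i, j) * v $ j))"
  have "cnj s = (\<Sum>i<n. \<Sum>j<n. cnj (v $ j) * (A $$ (j, i) * v $ i))"
    unfolding s_def cnj_sum
  proof (intro sum.cong refl)
    fix i j assume "i \<in> {..<n}" "j \<in> {..<n}"
    then have "cnj (A $$ (i, j)) = A $$ (j, i)"
      using sym[of i j] by (metis Reals_cnj_iff lessThan_iff)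
    then show "cnj (cnj (v $ i) * (A $$ (i, j) * v $ j)) = cnj (v $ j) * (A $$ (j, i) * v $ i)"
      by simp
  qed
  also have "\<dots> = s" unfolding s_def by (rule sum.swap)
  finally have "s \<in> \<real>" by (simp add: Reals_cnj_iff)
  define c where "c = (\<Sum>i<n. (cmod (v $ i))\<^sup>2)"
  have "s = (\<Sum>i<n. cnj (v $ i) * (k * v $ i))"
    unfolding s_def by (simp add: row flip: sum_distrib_left)
  also have "\<dots> = k * of_real c"
    unfolding c_def of_real_sum sum_distrib_left
    by (intro sum.cong refl) (simp add: complex_norm_square mult_ac del: of_real_power)
  finally have "s = k * of_real c" .
  obtain i where "i < n" "v $ i \<noteq> 0"
    using v by (metis eq_vecI carrier_vecD index_zero_vec)
  then have "c \<noteq> 0" unfolding c_def by (subst sum_nonneg_eq_0_iff) auto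
  then have "k = s / of_real c" using \<open>s = k * of_real c\<close> by simp
  then show ?thesis using \<open>s \<in> \<real>\<close> by auto
qed

section \<open>Quadratic polynomials in the adjacency matrix\<close>

definition adjacency :: "'v pair_pre_digraph \<Rightarrow> 'v \<Rightarrow> 'v \<Rightarrow> real" where
  "adjacency X x y = of_bool ((x, y) \<in> parcs X)"

text \<open>The entries of A^2 - a A + b I for the adjacency matrix A, indexed by vertices rather
  than positions, so that the enumeration chosen in \<open>spec\<close> disappears from later
  statements.\<close>

definition adjacency_quadratic ::
  "'v pair_pre_digraph \<Rightarrow> real \<Rightarrow> real \<Rightarrow> 'v \<Rightarrow> 'v \<Rightarrow> real"
where
  "adjacency_quadratic X a b x y =
     (\<Sum>z\<in>pverts X. adjacency X x z * adjacency X z y) - a * adjacency X x y + b * of_bool (x = y)"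

lemma spec_enumeration:
  assumes "finite (pverts X)"
  obtains vs where "distinct vs" "set vs = pverts X" "spec X = proots (char_poly (adjacency_mat X vs))"
proof -
  have "\<exists>vs. distinct vs \<and> set vs = pverts X"
    using finite_distinct_list[OF assms] by blast
  from someI_ex[OF this] show ?thesis by (intro that) (auto simp: spec_def)
qed

lemma adjacency_mat_carrier: "adjacency_mat X vs \<in> carrier_mat (length vs) (length vs)"
  by (simp add: adjacency_mat_def)

lemma adjacency_mat_index:
  assumes "i < length vs" "j < length vs"
  shows "adjacency_mat X vs $$ (i, j) = of_real (adjacency X (vs ! i) (vs ! j))"
  using assms by (simp add: adjacency_mat_def adjacency_def)

text \<open>The characteristic polynomial splits over the complex numbers, so it has as many roots
  as its degree. This later rules out the indices r = 0 and r = 1.\<close>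

lemma size_spec:
  assumes "finite (pverts X)"
  shows "size (spec X) = card (pverts X)"
proof -
  obtain vs where "distinct vs" "set vs = pverts X" "spec X = proots (char_poly (adjacency_mat X vs))"
    using spec_enumeration[OF assms] .
  then show ?thesis
    using degree_monic_char_poly[OF adjacency_mat_carrier, of X vs]
    by (metis size_proots_complex distinct_card)
qed

lemma spec_real:
  assumes "finite (pverts X)" "sym (parcs X)" "k \<in># spec X"
  shows "k \<in> \<real>"
proof -
  obtain vs where vs: "distinct vs" "set vs = pverts X"
      "spec X = proots (char_poly (adjacency_mat X vs))"
    using spec_enumeration[OF assms(1)] .
  let ?A = "adjacency_mat X vs"
  have "char_poly ?A \<noteq> 0"
    using degree_monic_char_poly[OF adjacency_mat_carrier, of X vs] by auto
  then have "poly (char_poly ?A) k = 0" using assms(3) vs(3) by simp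
  then have "eigenvalue ?A k" by (simp add: eigenvalue_root_char_poly[OF adjacency_mat_carrier])
  then show ?thesis
    by (rule eigenvalue_real_symmetric[OF adjacency_mat_carrier])
      (use assms(2) in \<open>auto simp: adjacency_mat_index adjacency_def dest: symD\<close>)
qed

lemma adjacency_sym: "sym (parcs X) \<Longrightarrow> adjacency X x y = adjacency X y x"
  by (auto simp: adjacency_def dest: symD)

lemma adjacency_quadratic_sym:
  assumes "sym (parcs X)"
  shows "adjacency_quadratic X a b x y = adjacency_quadratic X a b y x"
proof -
  have "adjacency X x z * adjacency X z y = adjacency X y z * adjacency X z x" for z
    using adjacency_sym[OF assms, of x z] adjacency_sym[OF assms, of z y] by simp
  then show ?thesis
    using adjacency_sym[OF assms, of x y] by (auto simp: adjacency_quadratic_def)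
qed

text \<open>The matrix N = A^2 - a A + b I is symmetric, so the trace of N^2 is the sum of the
  squares of its entries.\<close>

lemma sum_spec_quadratic_square:
  assumes "finite (pverts X)" "sym (parcs X)"
  shows "(\<Sum>k\<in>#spec X. (k\<^sup>2 - of_real a * k + of_real b)\<^sup>2) =
    of_real (\<Sum>x\<in>pverts X. \<Sum>y\<in>pverts X. (adjacency_quadratic X a b x y)\<^sup>2)"
proof -
  obtain vs where vs: "distinct vs" "set vs = pverts X"
      "spec X = proots (char_poly (adjacency_mat X vs))"
    using spec_enumeration[OF assms(1)] .
  define n where "n = length vs"
  define A where "A = adjacency_mat X vs"
  define N where "N = A * A + ((- of_real a) \<cdot>\<^sub>m A + of_real b \<cdot>\<^sub>m 1\<^sub>m n)"
  have A: "A \<in> carrier_mat n n" unfolding A_def n_def by (rule adjacency_mat_carrier)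
  then have Nc: "N \<in> carrier_mat n n" by (auto simp: N_def)
  have over_vs: "(\<Sum>i<n. h (vs ! i)) = sum h (pverts X)" for h :: "_ \<Rightarrow> complex"
    using sum.reindex_bij_betw[OF bij_betw_nth[OF vs(1) refl vs(2)[symmetric]]] by (simp add: n_def)
  have entry: "N $$ (i, j) = of_real (adjacency_quadratic X a b (vs ! i) (vs ! j))"
    if "i < n" "j < n" for i j
  proof -
    have "(A * A) $$ (i, j) = (\<Sum>k<n. A $$ (i, k) * A $$ (k, j))"
      using that A by (auto simp: scalar_prod_def lessThan_atLeast0)
    also have "\<dots> = (\<Sum>k<n. of_real (adjacency X (vs ! i) (vs ! k) * adjacency X (vs ! k) (vs ! j)))"
      using that by (intro sum.cong) (auto simp: A_def adjacency_mat_index n_def)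
    also have "\<dots> = of_real (\<Sum>z\<in>pverts X. adjacency X (vs ! i) z * adjacency X z (vs ! j))"
      by (subst over_vs) simp
    finally have "(A * A) $$ (i, j) = \<dots>" .
    moreover have "vs ! i = vs ! j \<longleftrightarrow> i = j"
      using that vs(1) by (simp add: n_def nth_eq_iff_index_eq)
    moreover have "A $$ (i, j) = of_real (adjacency X (vs ! i) (vs ! j))"
      using that by (simp add: A_def adjacency_mat_index n_def)
    ultimately show ?thesis
      using that A by (simp add: N_def adjacency_quadratic_def)
  qed
  have "(\<Sum>k\<in>#spec X. (k\<^sup>2 - of_real a * k + of_real b)\<^sup>2) = (\<Sum>i<n. (N * N) $$ (i, i))"
    using sum_eigenvalues_quadratic_square[OF A N_def] vs(3) by (simp add: A_def)
  also have "\<dots> = (\<Sum>i<n. \<Sum>j<n. N $$ (i, j) * N $$ (j, i))"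
    using Nc by (intro sum.cong) (auto simp: scalar_prod_def lessThan_atLeast0)
  also have "\<dots> = (\<Sum>i<n. \<Sum>j<n. of_real ((adjacency_quadratic X a b (vs ! i) (vs ! j))\<^sup>2))"
    using adjacency_quadratic_sym[OF assms(2)]
    by (intro sum.cong refl) (simp add: entry power2_eq_square)
  also have "\<dots> = of_real (\<Sum>x\<in>pverts X. \<Sum>y\<in>pverts X. (adjacency_quadratic X a b x y)\<^sup>2)"
    by (subst over_vs, subst over_vs) simp
  finally show ?thesis .
qed

text \<open>Since the spectrum is real, passing to \<open>Re\<close> loses nothing. Both sides
  become sums of real squares, whose signs can be exploited.\<close>

corollary sum_spec_quadratic_square_real:
  assumes "finite (pverts X)" "sym (parcs X)"
  shows "(\<Sum>k\<in>#spec X. ((Re k)\<^sup>2 - a * Re k + b)\<^sup>2) =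
    (\<Sum>x\<in>pverts X. \<Sum>y\<in>pverts X. (adjacency_quadratic X a b x y)\<^sup>2)"
proof -
  have "(k\<^sup>2 - of_real a * k + of_real b)\<^sup>2 = of_real (((Re k)\<^sup>2 - a * Re k + b)\<^sup>2)"
    if "k \<in># spec X" for k
    using spec_real[OF assms that] by (auto elim: Reals_cases)
  then have "(\<Sum>k\<in>#spec X. of_real (((Re k)\<^sup>2 - a * Re k + b)\<^sup>2)) =
      complex_of_real (\<Sum>x\<in>pverts X. \<Sum>y\<in>pverts X. (adjacency_quadratic X a b x y)\<^sup>2)"
    unfolding sum_spec_quadratic_square[OF assms, symmetric]
    by (intro arg_cong[of _ _ sum_mset] image_mset_cong) simp
  moreover have "(\<Sum>k\<in>#S. of_real (h k)) = complex_of_real (\<Sum>k\<in>#S. h k)"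
    for S :: "complex multiset" and h
    by (induction S) auto
  ultimately show ?thesis by (simp only: of_real_eq_iff)
qed

section \<open>Two-eigenvalue covers\<close>

locale graph_cover =
  fixes Y :: "'v pair_pre_digraph"
    and r :: nat
    and G :: "(nat \<Rightarrow> nat) set"
    and f :: "'v \<Rightarrow> 'v \<Rightarrow> (nat \<Rightarrow> nat) option"
  assumes base_graph: "pair_graph Y"
    and arc_function: "symmetric_arc_function Y r G f"
begin

text \<open>
  In \<^const>\<open>cover\<close>, \<open>f u v\<close> moves points of the fibre over \<open>v\<close> to the fibre over \<open>u\<close>; the voltage
  \<open>voltage u v\<close> goes from the fibre over \<open>u\<close> to that over \<open>v\<close>.
\<close>
definition voltage :: "'v \<Rightarrow> 'v \<Rightarrow> nat \<Rightarrow> nat" where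
  "voltage u v = the (f v u)"

lemma finite_base: "finite (pverts Y)"
  using base_graph by (simp add: pair_graph_def pair_digraph_def pair_fin_digraph_def
      pair_fin_digraph_axioms_def)

lemma sym_base: "sym (parcs Y)"
  using base_graph
  by (auto simp: pair_graph_def pair_pseudo_graph_def pair_sym_digraph_def
      pair_sym_digraph_axioms_def symmetric_def)

lemma irrefl_base: "(u, u) \<notin> parcs Y"
  using pair_loopfree_digraph.pair_no_loops[of Y "(u, u)"] base_graph
  by (auto simp: pair_graph_def pair_digraph_def)

lemma base_arcD:
  assumes "(u, v) \<in> parcs Y"
  shows "u \<in> pverts Y" "v \<in> pverts Y"
  using assms pair_wf_digraph.wellformed'[of Y u v] base_graph
  by (auto simp: pair_graph_def pair_digraph_def pair_fin_digraph_def)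

lemma
  assumes "(u, v) \<in> parcs Y"
  shows f_eq_voltage: "f v u = Some (voltage u v)"
    and voltage_permutes: "voltage u v permutes {1..r}"
    and voltage_inv: "voltage v u = inv' (voltage u v)"
proof -
  note uv = base_arcD[OF assms]
  obtain g where g: "f u v = Some g"
    using uv assms arc_function unfolding symmetric_arc_function_def
    by (metis option.exhaust)
  then have *: "g \<in> G" "f v u = Some (inv\<^bsub>sym_group r\<^esub> g)" "subgroup G (sym_group r)"
    using uv arc_function by (auto simp: symmetric_arc_function_def)
  then have "g permutes {1..r}" by (metis subgroup.mem_carrier sym_group_carrier)
  then show "f v u = Some (voltage u v)" "voltage u v permutes {1..r}" "voltage v u = inv' (voltage u v)"
    using g * by (simp_all add: voltage_def sym_group_carrier permutes_inv permutes_inv_inv)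
qed

lemma voltage_mem: "(u, v) \<in> parcs Y \<Longrightarrow> voltage u v j \<in> {1..r} \<longleftrightarrow> j \<in> {1..r}"
  using voltage_permutes permutes_in_image by metis

lemma voltage_eq_iff: "(u, v) \<in> parcs Y \<Longrightarrow> voltage v u k = j \<longleftrightarrow> voltage u v j = k"
  using voltage_permutes[of u v] by (auto simp: voltage_inv permutes_inverses)

lemma pverts_cover: "pverts (cover Y r f) = pverts Y \<times> {1..r}"
  by (simp add: cover_def)

lemma cover_arc_iff:
  "((u, j), (v, k)) \<in> parcs (cover Y r f) \<longleftrightarrow> (u, v) \<in> parcs Y \<and> j \<in> {1..r} \<and> k = voltage u v j"
  using voltage_mem[of u v j] by (auto simp: cover_def f_eq_voltage)

lemma finite_cover: "finite (pverts (cover Y r f))"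
  by (simp add: pverts_cover finite_base)

lemma sym_cover: "sym (parcs (cover Y r f))"
proof (rule symI)
  fix x y assume *: "(x, y) \<in> parcs (cover Y r f)"
  obtain u j v k where xy: "x = (u, j)" "y = (v, k)" by fastforce
  with * have arc: "(u, v) \<in> parcs Y" "j \<in> {1..r}" "k = voltage u v j" by (auto simp: cover_arc_iff)
  then have "j = voltage v u k" "k \<in> {1..r}"
    using voltage_eq_iff[of u v k j] voltage_mem[of u v j] by auto
  then show "(y, x) \<in> parcs (cover Y r f)"
    using xy arc symD[OF sym_base] by (simp add: cover_arc_iff)
qed

lemma cover_arcD:
  assumes "(x, y) \<in> parcs (cover Y r f)"
  shows "x \<in> pverts (cover Y r f)" "y \<in> pverts (cover Y r f)"
proof -
  obtain u j v k where xy: "x = (u, j)" "y = (v, k)" by fastforce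
  then show "x \<in> pverts (cover Y r f)" "y \<in> pverts (cover Y r f)"
    using assms base_arcD[of u v] voltage_mem[of u v j] by (auto simp: cover_arc_iff pverts_cover)
qed

lemma cover_graph: "pair_graph (cover Y r f)"
proof
  show "finite (parcs (cover Y r f))"
    by (rule finite_subset[OF _ finite_cartesian_product[OF finite_cover finite_cover]])
      (auto dest: cover_arcD)
  show "symmetric (with_proj (cover Y r f))"
    using sym_cover by (simp add: symmetric_def)
  show "fst e \<noteq> snd e" if "e \<in> parcs (cover Y r f)" for e
    using that irrefl_base by (cases e) (auto simp: cover_arc_iff)
qed (use finite_cover cover_arcD in auto)

section \<open>Fibre sums and comparison of the two spectra\<close>

lemma sum_pverts_cover: "sum h (pverts (cover Y r f)) = (\<Sum>u\<in>pverts Y. \<Sum>j=1..r. h (u, j))"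
  by (simp only: pverts_cover sum.cartesian_product prod.case_distrib case_prod_eta)

text \<open>Above an edge of \<open>Y\<close> the two fibres are joined by a perfect matching, so
  each point has exactly one neighbour in the other fibre; above a non-edge there is none.\<close>

lemma sum_adjacency_fibre:
  assumes "j \<in> {1..r}"
  shows "(\<Sum>k=1..r. adjacency (cover Y r f) (u, j) (v, k)) = adjacency Y u v"
proof (cases "(u, v) \<in> parcs Y")
  case True
  then have "(\<Sum>k=1..r. adjacency (cover Y r f) (u, j) (v, k)) =
      (\<Sum>k=1..r. if k = voltage u v j then 1 else 0)"
    using assms by (intro sum.cong) (auto simp: adjacency_def cover_arc_iff)
  also have "\<dots> = 1" using voltage_mem[OF True] assms by simp
  finally show ?thesis using True by (simp add: adjacency_def)
qed (simp add: adjacency_def cover_arc_iff)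

text \<open>The fibres form an equitable partition whose quotient matrix is the adjacency matrix of
  \<open>Y\<close>. Summing first over the last fibre and then over the middle one extends this from
  A to A^2.\<close>

lemma sum_adjacency_quadratic_fibre:
  assumes "j \<in> {1..r}"
  shows "(\<Sum>k=1..r. adjacency_quadratic (cover Y r f) a b (u, j) (v, k)) = adjacency_quadratic Y a b u v"
proof -
  let ?A = "adjacency (cover Y r f)"
  have "(\<Sum>k=1..r. \<Sum>z\<in>pverts (cover Y r f). ?A (u, j) z * ?A z (v, k)) =
      (\<Sum>z\<in>pverts (cover Y r f). ?A (u, j) z * (\<Sum>k=1..r. ?A z (v, k)))"
    by (subst sum.swap) (simp add: sum_distrib_left)
  also have "\<dots> = (\<Sum>w\<in>pverts Y. \<Sum>l=1..r. ?A (u, j) (w, l) * (\<Sum>k=1..r. ?A (w, l) (v, k)))"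
    by (rule sum_pverts_cover)
  also have "\<dots> = (\<Sum>w\<in>pverts Y. \<Sum>l=1..r. ?A (u, j) (w, l) * adjacency Y w v)"
    by (intro sum.cong refl) (simp only: sum_adjacency_fibre)
  also have "\<dots> = (\<Sum>w\<in>pverts Y. adjacency Y u w * adjacency Y w v)"
    by (simp only: sum_adjacency_fibre[OF assms] flip: sum_distrib_right)
  finally have walks: "(\<Sum>k=1..r. \<Sum>z\<in>pverts (cover Y r f). ?A (u, j) z * ?A z (v, k)) = \<dots>" .
  have "(\<Sum>k=1..r. b * of_bool ((u, j) = (v, k))) = b * of_bool (u = v)"
    using assms by (simp add: of_bool_def if_distrib cong: if_cong)
  then show ?thesis
    unfolding adjacency_quadratic_def
    by (simp only: sum.distrib sum_subtractf walks sum_adjacency_fibre[OF assms] flip: sum_distrib_left)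
qed

lemma two_ev_cover_quadratic:
  assumes "two_ev_cover Y r f"
  obtains a b where "2 \<le> r"
    and "\<And>u v j k. u \<in> pverts Y \<Longrightarrow> v \<in> pverts Y \<Longrightarrow> j \<in> {1..r} \<Longrightarrow> k \<in> {1..r} \<Longrightarrow>
      adjacency_quadratic (cover Y r f) a b (u, j) (v, k) = adjacency_quadratic Y a b u v / real r"
proof -
  let ?X = "cover Y r f"
  \<comment> \<open>That \<open>spec Y\<close> is contained in \<open>spec ?X\<close> is not
    presupposed. Multiset difference truncates, so \<open>E\<close> records a possible excess of
    \<open>spec Y\<close>; it is shown to be empty below.\<close>
  define D E where "D = spec ?X - spec Y" and "E = spec Y - spec ?X"
  obtain \<theta> \<tau> where D: "set_mset D = {\<theta>, \<tau>}"
    using assms by (auto simp: two_ev_cover_def card_2_iff D_def)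
  have DE: "spec ?X + E = spec Y + D"
    by (auto simp: D_def E_def multiset_eq_iff)
  have disj: "k \<notin># E" if "k \<in># D" for k
    using that by (auto simp: D_def E_def in_diff_count)
  have real: "k \<in> \<real>" if "k \<in># D \<or> k \<in># E" for k
    using that spec_real[OF finite_cover sym_cover] spec_real[OF finite_base sym_base]
    by (auto simp: D_def E_def dest: in_diffD)
  \<comment> \<open>The new eigenvalues are real, so their real parts give the real coefficients of
    the quadratic that vanishes on \<open>D\<close>.\<close>
  define a b where "a = Re \<theta> + Re \<tau>" and "b = Re \<theta> * Re \<tau>"
  define p where "p k = ((Re k)\<^sup>2 - a * Re k + b)\<^sup>2" for k
  have p: "p k = ((Re k - Re \<theta>) * (Re k - Re \<tau>))\<^sup>2" for k
    by (simp add: p_def a_def b_def algebra_simps power2_eq_square)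
  let ?N = "adjacency_quadratic ?X a b" and ?M = "adjacency_quadratic Y a b"
  have "(\<Sum>k\<in>#D. p k) = 0"
    using D by (auto simp: p intro!: sum_mset.neutral)
  then have "(\<Sum>k\<in>#spec ?X. p k) + (\<Sum>k\<in>#E. p k) = (\<Sum>k\<in>#spec Y. p k)"
    using arg_cong[OF DE, of "\<lambda>S. \<Sum>k\<in>#S. p k"] by simp
  then have norms: "(\<Sum>x\<in>pverts ?X. \<Sum>y\<in>pverts ?X. (?N x y)\<^sup>2) + (\<Sum>k\<in>#E. p k) =
      (\<Sum>u\<in>pverts Y. \<Sum>v\<in>pverts Y. (?M u v)\<^sup>2)"
    unfolding p_def sum_spec_quadratic_square_real[OF finite_cover sym_cover]
      sum_spec_quadratic_square_real[OF finite_base sym_base] .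
  have "spec ?X \<noteq> {#}" using D by (auto simp: D_def)
  then have "r \<noteq> 0" using size_spec[OF finite_cover]
    by (auto simp: pverts_cover card_cartesian_product intro: gr0I)
  \<comment> \<open>The exact form of the Cauchy-Schwarz bound: the entries in a row of a fibre
    block have mean \<open>?M u v / r\<close>, and this is their variance identity.\<close>
  have deviation: "(\<Sum>k=1..r. (?N (u, j) (v, k) - ?M u v / r)\<^sup>2) =
      (\<Sum>k=1..r. (?N (u, j) (v, k))\<^sup>2) - (?M u v)\<^sup>2 / r"
    if "j \<in> {1..r}" for u v j
  proof -
    have "(\<Sum>k=1..r. (?N (u, j) (v, k) - ?M u v / r)\<^sup>2) =
        (\<Sum>k=1..r. (?N (u, j) (v, k))\<^sup>2 - 2 * (?M u v / r) * ?N (u, j) (v, k) + (?M u v / r)\<^sup>2)"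
      by (intro sum.cong refl) (simp add: power2_diff)
    also have "\<dots> = (\<Sum>k=1..r. (?N (u, j) (v, k))\<^sup>2) - 2 * (?M u v / r) * ?M u v + r * (?M u v / r)\<^sup>2"
      by (simp only: sum.distrib sum_subtractf sum_adjacency_quadratic_fibre[OF that] sum_constant
          card_atLeastAtMost flip: sum_distrib_left) simp
    also have "\<dots> = (\<Sum>k=1..r. (?N (u, j) (v, k))\<^sup>2) - (?M u v)\<^sup>2 / r"
      using \<open>r \<noteq> 0\<close> by (simp add: field_simps power2_eq_square)
    finally show ?thesis .
  qed
  define dev where "dev = (\<lambda>(u, j) (v, k). (?N (u, j) (v, k) - ?M u v / r)\<^sup>2)"
  have dev_nonneg: "0 \<le> dev x y" for x y by (simp add: dev_def split_def)
  have "(\<Sum>x\<in>pverts ?X. \<Sum>y\<in>pverts ?X. dev x y) =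
      (\<Sum>u\<in>pverts Y. \<Sum>j=1..r. \<Sum>v\<in>pverts Y. \<Sum>k=1..r. (?N (u, j) (v, k) - ?M u v / r)\<^sup>2)"
    by (simp only: sum_pverts_cover dev_def split_conv)
  also have "\<dots> = (\<Sum>u\<in>pverts Y. \<Sum>j=1..r. \<Sum>v\<in>pverts Y. (\<Sum>k=1..r. (?N (u, j) (v, k))\<^sup>2) - (?M u v)\<^sup>2 / r)"
    by (intro sum.cong refl deviation)
  \<comment> \<open>The subtracted term does not depend on \<open>j\<close>, so its r copies cancel
    the factor 1/r.\<close>
  also have "\<dots> = (\<Sum>u\<in>pverts Y. \<Sum>j=1..r. \<Sum>v\<in>pverts Y. \<Sum>k=1..r. (?N (u, j) (v, k))\<^sup>2) -
      (\<Sum>u\<in>pverts Y. \<Sum>v\<in>pverts Y. (?M u v)\<^sup>2)"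
    using \<open>r \<noteq> 0\<close> by (simp add: sum_subtractf sum_distrib_left)
  also have "(\<Sum>u\<in>pverts Y. \<Sum>j=1..r. \<Sum>v\<in>pverts Y. \<Sum>k=1..r. (?N (u, j) (v, k))\<^sup>2) =
      (\<Sum>x\<in>pverts ?X. \<Sum>y\<in>pverts ?X. (?N x y)\<^sup>2)"
    by (simp only: sum_pverts_cover)
  \<comment> \<open>Two nonnegative quantities add up to zero, so both vanish: the first fixes the
    entries of \<open>?N\<close>, the second empties \<open>E\<close>.\<close>
  finally have dev: "(\<Sum>x\<in>pverts ?X. \<Sum>y\<in>pverts ?X. dev x y) + (\<Sum>k\<in>#E. p k) = 0"
    using norms by linarith
  moreover have "0 \<le> (\<Sum>x\<in>pverts ?X. \<Sum>y\<in>pverts ?X. dev x y)"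
    by (intro sum_nonneg dev_nonneg)
  moreover have p_nonneg: "0 \<le> (\<Sum>k\<in>#S. p k)" for S
    by (induction S) (auto simp: p)
  ultimately have dev0: "(\<Sum>x\<in>pverts ?X. \<Sum>y\<in>pverts ?X. dev x y) = 0"
    and E0: "(\<Sum>k\<in>#E. p k) = 0"
    using p_nonneg[of E] by linarith+
  \<comment> \<open>A member of \<open>E\<close> would be a real root of the quadratic, hence one of
    the two new eigenvalues and a member of \<open>D\<close>, but \<open>D\<close> and
    \<open>E\<close> are disjoint.\<close>
  have "k \<notin># E" for k
  proof
    assume k: "k \<in># E"
    then obtain E' where "E = add_mset k E'" by (metis multi_member_split)
    then have "p k = 0" using E0 p_nonneg[of E'] by (simp add: p add_nonneg_eq_0_iff)
    then have "Re k = Re \<theta> \<or> Re k = Re \<tau>" by (simp add: p)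
    then have "k \<in># D"
      using real[of k] real[of \<theta>] real[of \<tau>] k
      by (auto simp: D complex_is_Real_iff complex_eq_iff)
    with disj k show False by blast
  qed
  then have "E = {#}" by (metis multiset_nonemptyE)
  \<comment> \<open>With index 1 both spectra have the same size, and as \<open>E\<close> is empty
    no eigenvalue could be new.\<close>
  have "r \<noteq> 1"
  proof
    assume "r = 1"
    then have "size (spec ?X) = size (spec Y)"
      unfolding size_spec[OF finite_cover] size_spec[OF finite_base] pverts_cover
      by (simp add: card_cartesian_product)
    then have "D = {#}" using arg_cong[OF DE, of size] \<open>E = {#}\<close> by simp
    with D show False by simp
  qed
  then have "2 \<le> r" using \<open>r \<noteq> 0\<close> by linarith
  moreover have "?N (u, j) (v, k) = ?M u v / r"
    if "u \<in> pverts Y" "v \<in> pverts Y" "j \<in> {1..r}" "k \<in> {1..r}" for u v j k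
  proof -
    have "(\<Sum>y\<in>pverts ?X. dev (u, j) y) = 0"
      using dev0 that
      by (subst (asm) sum_nonneg_eq_0_iff) (auto intro!: sum_nonneg dev_nonneg simp: finite_base pverts_cover)
    then have "dev (u, j) (v, k) = 0"
      using that
      by (subst (asm) sum_nonneg_eq_0_iff) (auto intro!: dev_nonneg simp: finite_base pverts_cover)
    then show ?thesis by (simp add: dev_def)
  qed
  ultimately show ?thesis by (rule that)
qed

end

section \<open>Connectedness and distance\<close>

text \<open>Connectedness is defined through the symmetric closure of the arcs, which adds nothing
  when the arcs are already symmetric.\<close>

lemma connected_rtrancl:
  assumes "Digraph_Component.connected (with_proj X)" "sym (parcs X)" "x \<in> pverts X" "y \<in> pverts X"
  shows "(x, y) \<in> (parcs X)\<^sup>*"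
proof -
  have "x \<rightarrow>\<^sup>*\<^bsub>with_proj (mk_symmetric (with_proj X))\<^esub> y"
    using assms(1,3,4)
    unfolding Digraph_Component.connected_def Digraph_Component.strongly_connected_def
    by (simp add: mk_symmetric_def)
  then show ?thesis
    unfolding reachable_def
  proof (induction rule: rtrancl_on_induct)
    case (step y z)
    then have "(y, z) \<in> parcs X"
      using assms(2) by (auto simp: mk_symmetric_def dest: symD)
    with step show ?case by (meson rtrancl.rtrancl_into_rtrancl)
  qed simp
qed

lemma connected_complete:
  assumes "pverts X \<noteq> {}" "parcs X = {(x, y). x \<in> pverts X \<and> y \<in> pverts X \<and> x \<noteq> y}"
  shows "Digraph_Component.connected (with_proj X)"
  unfolding Digraph_Component.connected_def
proof (rule strongly_connectedI)
  let ?S = "mk_symmetric (with_proj X)"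
  fix x y assume "x \<in> verts (with_proj ?S)" "y \<in> verts (with_proj ?S)"
  then have xy: "x \<in> pverts ?S" "y \<in> pverts ?S" by auto
  show "x \<rightarrow>\<^sup>*\<^bsub>with_proj ?S\<^esub> y"
  proof (cases "x = y")
    case False
    then have "(x, y) \<in> parcs ?S"
      using xy assms(2) by (force simp: mk_symmetric_def)
    then show ?thesis
      unfolding reachable_def using xy
      by (auto intro: rtrancl_on_into_rtrancl_on[OF rtrancl_on_refl])
  qed (use xy in \<open>auto simp: reachable_def\<close>)
qed (use assms(1) in \<open>auto simp: mk_symmetric_def\<close>)

text \<open>Replaces walks by powers of the arc relation, so that a distance becomes a least
  exponent.\<close>

lemma (in pair_wf_digraph) awalk_length_iff_relpow:
  "(\<exists>p. awalk x p y \<and> length p = k) \<longleftrightarrow> x \<in> pverts G \<and> (x, y) \<in> parcs G ^^ k"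
proof (induction k arbitrary: x)
  case 0
  then show ?case by (auto simp: awalk_Nil_iff)
next
  case (Suc k)
  have "(\<exists>p. awalk x p y \<and> length p = Suc k) \<longleftrightarrow>
      (\<exists>z. (x, z) \<in> parcs G \<and> (\<exists>p. awalk z p y \<and> length p = k))"
  proof -
    have "(\<exists>p. awalk x p y \<and> length p = Suc k) \<longleftrightarrow> (\<exists>e p. awalk x (e # p) y \<and> length p = k)"
      by (auto simp: length_Suc_conv)
    then show ?thesis by (auto simp: awalk_Cons_iff)
  qed
  also have "\<dots> \<longleftrightarrow> (x, y) \<in> parcs G O parcs G ^^ k"
    unfolding Suc by (auto dest: in_arcsD2)
  also have "\<dots> \<longleftrightarrow> x \<in> pverts G \<and> (x, y) \<in> parcs G ^^ Suc k"
    unfolding relpow.simps relpow_commute[symmetric] by (auto dest: in_arcsD1)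
  finally show ?case .
qed

lemma distance_eq_relpow:
  assumes "pair_wf_digraph X" "x \<in> pverts X"
  shows "distance X x y = (LEAST k. (x, y) \<in> parcs X ^^ k)"
  unfolding distance_def pair_wf_digraph.awalk_length_iff_relpow[OF assms(1)] using assms(2) by simp

section \<open>Covers of complete graphs\<close>

locale complete_cover = graph_cover Y r G f
  for Y :: "'v pair_pre_digraph" and r G f +
  assumes complete: "parcs Y = {(u, v). u \<in> pverts Y \<and> v \<in> pverts Y \<and> u \<noteq> v}"
begin

abbreviation "V \<equiv> pverts (cover Y r f)"
abbreviation "E \<equiv> parcs (cover Y r f)"

definition common_neighbours :: "'v \<times> nat \<Rightarrow> 'v \<times> nat \<Rightarrow> ('v \<times> nat) set" where
  "common_neighbours x y = {z. (x, z) \<in> E \<and> (z, y) \<in> E}"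

section \<open>Neighbours and common neighbours\<close>

lemma arc_iff:
  "((u, j), (v, k)) \<in> E \<longleftrightarrow>
    u \<in> pverts Y \<and> v \<in> pverts Y \<and> u \<noteq> v \<and> j \<in> {1..r} \<and> k = voltage u v j"
  by (auto simp: cover_arc_iff complete)

lemma arc_sym: "(x, y) \<in> E \<Longrightarrow> (y, x) \<in> E"
  using sym_cover by (rule symD)

lemma common_neighbours_iff: "z \<in> common_neighbours x y \<longleftrightarrow> (x, z) \<in> E \<and> (y, z) \<in> E"
  by (auto simp: common_neighbours_def intro: arc_sym)

lemma arc_fst_neq: "(x, y) \<in> E \<Longrightarrow> fst x \<noteq> fst y"
  by (cases x; cases y) (auto simp: arc_iff)

lemma arc_irrefl: "(x, x) \<notin> E"
  using arc_fst_neq by blast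

lemma neighbour_in_fibre:
  assumes "x \<in> V" "v \<in> pverts Y" "v \<noteq> fst x"
  shows "{z. (x, z) \<in> E \<and> fst z = v} = {(v, voltage (fst x) v (snd x))}"
  using assms by (cases x) (auto simp: arc_iff pverts_cover)

text \<open>Voltages in opposite directions are inverse bijections, so going from a fibre to z and
  back returns to the starting point. Hence distinct points of one fibre have no common neighbour,
  which later puts them at distance 3.\<close>

lemma fibre_neighbour_unique:
  assumes "(x, z) \<in> E" "(z, y) \<in> E" "fst x = fst y"
  shows "x = y"
proof -
  obtain u j w l k where xyz: "x = (u, j)" "z = (w, l)" "y = (u, k)"
    using assms(3) by (metis prod.collapse)
  then have "voltage u w j = l" "k = voltage w u l" "(u, w) \<in> parcs Y"
    using assms(1,2) by (auto simp: arc_iff complete)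
  then show ?thesis using voltage_eq_iff[of u w l j] xyz by simp
qed

lemma card_neighbours:
  assumes "x \<in> V"
  shows "card {z. (x, z) \<in> E} = card (pverts Y) - 1"
proof -
  obtain u j where x: "x = (u, j)" by fastforce
  with assms have uj: "u \<in> pverts Y" "j \<in> {1..r}" by (auto simp: pverts_cover)
  then have "{z. (x, z) \<in> E} = (\<lambda>v. (v, voltage u v j)) ` (pverts Y - {u})"
    by (auto simp: x arc_iff)
  then have "card {z. (x, z) \<in> E} = card (pverts Y - {u})"
    by (simp add: card_image inj_on_def)
  then show ?thesis using uj finite_base by simp
qed

lemma finite_neighbours: "finite {z. (x, z) \<in> E}"
  by (rule finite_subset[OF _ finite_cover]) (auto dest: cover_arcD)

text \<open>For x and y in distinct fibres the identity term of the quadratic vanishes, leaving the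
  number of common neighbours minus a if x and y are adjacent. This is 1/r times the corresponding
  entry for the complete graph.\<close>

lemma card_common_neighbours:
  assumes "two_ev_cover Y r f"
  obtains l m where "2 \<le> r"
    and "\<And>x y. x \<in> V \<Longrightarrow> y \<in> V \<Longrightarrow> fst x \<noteq> fst y \<Longrightarrow>
      card (common_neighbours x y) = (if (x, y) \<in> E then l else m)"
proof -
  have walks: "(\<Sum>z\<in>pverts X. adjacency X x z * adjacency X z y) =
      real (card {z \<in> pverts X. (x, z) \<in> parcs X \<and> (z, y) \<in> parcs X})"
    if "finite (pverts X)" for X :: "'w pair_pre_digraph" and x y
    using that by (simp add: adjacency_def Int_def flip: of_bool_conj)
  obtain a b where "2 \<le> r"
    and N: "\<And>u v j k. u \<in> pverts Y \<Longrightarrow> v \<in> pverts Y \<Longrightarrow> j \<in> {1..r} \<Longrightarrow> k \<in> {1..r} \<Longrightarrow>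
      adjacency_quadratic (cover Y r f) a b (u, j) (v, k) = adjacency_quadratic Y a b u v / real r"
    using two_ev_cover_quadratic[OF assms] by blast
  \<comment> \<open>Two vertices of the complete graph on n vertices have n - 2 common neighbours
    and are adjacent, so its off-diagonal entry is n - 2 - a.\<close>
  define c where "c = (real (card (pverts Y) - 2) - a) / r"
  have "real (card (common_neighbours x y)) = (if (x, y) \<in> E then a + c else c)"
    if xy: "x \<in> V" "y \<in> V" and "fst x \<noteq> fst y" for x y
  proof -
    obtain u j v k where *: "x = (u, j)" "y = (v, k)" by fastforce
    then have uv: "u \<in> pverts Y" "v \<in> pverts Y" "u \<noteq> v" "j \<in> {1..r}" "k \<in> {1..r}"
      using that by (auto simp: pverts_cover)
    have "{z \<in> pverts Y. (u, z) \<in> parcs Y \<and> (z, v) \<in> parcs Y} = pverts Y - {u, v}"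
      using uv by (auto simp: complete)
    then have "card {z \<in> pverts Y. (u, z) \<in> parcs Y \<and> (z, v) \<in> parcs Y} = card (pverts Y) - 2"
      using uv by (simp add: card_Diff_subset)
    moreover have "adjacency Y u v = 1" using uv by (simp add: adjacency_def complete)
    ultimately have "adjacency_quadratic Y a b u v = real (card (pverts Y) - 2) - a"
      using uv unfolding adjacency_quadratic_def walks[OF finite_base] by simp
    moreover have "{z \<in> V. (x, z) \<in> E \<and> (z, y) \<in> E} = common_neighbours x y"
      by (auto simp: common_neighbours_def dest: cover_arcD)
    then have "adjacency_quadratic (cover Y r f) a b x y =
        real (card (common_neighbours x y)) - a * of_bool ((x, y) \<in> E)"
      using uv * unfolding adjacency_quadratic_def walks[OF finite_cover]
      by (simp add: adjacency_def)
    ultimately show ?thesis using N[OF uv(1,2,4,5)] * by (simp add: c_def)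
  qed
  \<comment> \<open>Only a value attained by some pair is known to be a natural number. Taking
    floors defines both constants in every case and is exact where a pair attains the value.\<close>
  then have "card (common_neighbours x y) = (if (x, y) \<in> E then nat \<lfloor>a + c\<rfloor> else nat \<lfloor>c\<rfloor>)"
    if "x \<in> V" "y \<in> V" "fst x \<noteq> fst y" for x y
    using that by (metis floor_of_nat nat_int)
  with \<open>2 \<le> r\<close> show ?thesis by (rule that)
qed

end

text \<open>Collects what the spectral argument delivers; the rest is counting. In the usual
  notation \<open>l\<close> is a_1 and \<open>m\<close> is c_2.\<close>

locale regular_complete_cover = complete_cover Y r G f
  for Y :: "'v pair_pre_digraph" and r G f +
  fixes l m :: nat
  assumes conn: "Digraph_Component.connected (with_proj (cover Y r f))"
    and index_ge_2: "2 \<le> r"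
    and card_common: "\<And>x y. x \<in> V \<Longrightarrow> y \<in> V \<Longrightarrow> fst x \<noteq> fst y \<Longrightarrow>
      card (common_neighbours x y) = (if (x, y) \<in> E then l else m)"
begin

section \<open>Distances and intersection numbers\<close>

lemma base_nonempty: "pverts Y \<noteq> {}"
  using conn unfolding Digraph_Component.connected_def Digraph_Component.strongly_connected_def
  by (auto simp: mk_symmetric_def pverts_cover)

lemma same_fibre_pair:
  obtains u where "(u, 1) \<in> V" "(u, 2) \<in> V"
  using base_nonempty index_ge_2 by (auto simp: pverts_cover)

lemma ex_other_base_vertex: "\<exists>v\<in>pverts Y. v \<noteq> u"
proof (rule ccontr)
  assume "\<not> ?thesis"
  then have "parcs Y = {}" unfolding complete by (auto, metis)
  then have "E = {}" by (simp add: cover_def)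
  obtain w where "(w, 1) \<in> V" "(w, 2) \<in> V" by (rule same_fibre_pair)
  from connected_rtrancl[OF conn sym_cover this] show False by (simp add: \<open>E = {}\<close>)
qed

text \<open>
  Otherwise being equal or adjacent would be a transitive relation, and the cover would be a
  disjoint union of complete graphs.
\<close>
lemma nonadjacent_common_pos: "m \<noteq> 0"
proof
  assume "m = 0"
  obtain w where w: "(w, 1) \<in> V" "(w, 2) \<in> V" by (rule same_fibre_pair)
  have "x = (w, 1) \<or> ((w, 1), x) \<in> E" if "((w, 1), x) \<in> E\<^sup>*" for x
    using that
  proof (induction rule: rtrancl_induct)
    case (step y z)
    show ?case
    proof (cases "fst z = w")
      case True
      then show ?thesis using step fibre_neighbour_unique[of "(w, 1)" y z] arc_fst_neq by auto
    next
      case False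
      show ?thesis
      proof (rule ccontr)
        assume *: "\<not> ?thesis"
        then have "((w, 1), y) \<in> E" using step by auto
        then have "y \<in> common_neighbours (w, 1) z" using step by (auto simp: common_neighbours_def)
        moreover have "finite (common_neighbours (w, 1) z)"
          by (rule finite_subset[OF _ finite_neighbours]) (auto simp: common_neighbours_def)
        ultimately have "card (common_neighbours (w, 1) z) \<noteq> 0" by auto
        then show False
          using card_common[of "(w, 1)" z] w cover_arcD(2)[OF step(2)] False * \<open>m = 0\<close> by auto
      qed
    qed
  qed simp
  \<comment> \<open>The point \<open>(w, 2)\<close> is reachable from \<open>(w, 1)\<close>, but
    being another point of the same fibre it is neither equal nor adjacent to it.\<close>
  from this[OF connected_rtrancl[OF conn sym_cover w]] show False using arc_fst_neq by fastforce
qed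

text \<open>Non-adjacent points of distinct fibres have a common neighbour since \<open>m\<close> is
  nonzero. For distinct x and y in one fibre, a neighbour z of x is not adjacent to y, so z reaches
  y in two steps; a walk of length at most 2 from x to y is impossible.\<close>

lemma distance_cover:
  assumes "x \<in> V" "y \<in> V"
  shows "distance (cover Y r f) x y =
    (if x = y then 0 else if (x, y) \<in> E then 1 else if fst x \<noteq> fst y then 2 else 3)"
proof -
  have common: "(x, y) \<in> E ^^ 2" if "x \<in> V" "y \<in> V" "(x, y) \<notin> E" "fst x \<noteq> fst y" for x y
  proof -
    have "common_neighbours x y \<noteq> {}"
      using card_common[OF that(1,2,4)] that(3) nonadjacent_common_pos by auto
    then show ?thesis by (auto simp: common_neighbours_def numeral_2_eq_2)
  qed
  have three: "(x, y) \<in> E ^^ 3" if "x \<noteq> y" "fst x = fst y"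
  proof -
    obtain v where v: "v \<in> pverts Y" "v \<noteq> fst x" using ex_other_base_vertex by blast
    obtain z where z: "(x, z) \<in> E" "fst z = v"
      using neighbour_in_fibre[OF assms(1) v] by blast
    then have "(z, y) \<notin> E" using fibre_neighbour_unique that by blast
    then have "(z, y) \<in> E ^^ 2"
      using common[of z y] z v that assms cover_arcD(2) by auto
    from relpow_Suc_I2[OF z(1) this] show ?thesis by (simp only: numeral_3_eq_3 numeral_2_eq_2)
  qed
  have two: "\<exists>z. (x, z) \<in> E \<and> (z, y) \<in> E" if "(x, y) \<in> E ^^ 2"
    using that by (auto simp: numeral_2_eq_2)
  have wf: "pair_wf_digraph (cover Y r f)"
    using cover_graph by (simp add: pair_graph_def pair_digraph_def pair_fin_digraph_def)
  show ?thesis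
    unfolding distance_eq_relpow[OF wf assms(1)]
  proof (rule Least_equality, goal_cases)
    case 1
    then show ?case using common[OF assms] three by auto
  next
    case (2 k)
    have "k \<noteq> 0" if "x \<noteq> y" using that 2 by (auto intro: gr0I)
    moreover have "k \<noteq> 1" if "(x, y) \<notin> E" using that 2 by auto
    moreover have "k \<noteq> 2" if "x \<noteq> y" "fst x = fst y"
      using that 2 two fibre_neighbour_unique by blast
    ultimately show ?case by (auto simp: not_less_eq_eq)
  qed
qed

lemma card_neighbours_further:
  assumes "v \<in> V" "w \<in> V"
  shows "card {x. (w, x) \<in> E \<and> distance (cover Y r f) v x = distance (cover Y r f) v w + 1} =
    (if v = w then card (pverts Y) - 1
     else if (v, w) \<in> E then card (pverts Y) - 1 - 1 - l
     else if fst v \<noteq> fst w then 1 else 0)"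
  (is "card ?S = _")
proof -
  note d = distance_cover[OF assms] distance_cover[OF assms(1) cover_arcD(2)[of w]]
  consider (same) "v = w" | (adj) "v \<noteq> w" "(v, w) \<in> E" | (nonadj) "v \<noteq> w" "(v, w) \<notin> E" "fst v \<noteq> fst w"
    | (fibre) "v \<noteq> w" "(v, w) \<notin> E" "fst v = fst w" by blast
  then show ?thesis
  proof cases
    case same
    have S: "?S = {x. (w, x) \<in> E}" using d arc_irrefl unfolding same by auto
    show ?thesis unfolding S using same by (simp add: card_neighbours assms)
  next
    case adj
    \<comment> \<open>A neighbour of w in the fibre of v must be v itself, so the neighbours of w
      that are neither v nor adjacent to v lie in other fibres, at distance 2 from v.\<close>
    have "x \<in> ?S \<longleftrightarrow> x \<in> {x. (w, x) \<in> E} - {v} - common_neighbours v w" for x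
      using adj d(1) d(2)[of x] fibre_neighbour_unique[OF adj(2), of x]
      by (auto simp: common_neighbours_iff split: if_splits)
    then have S: "?S = {x. (w, x) \<in> E} - {v} - common_neighbours v w" by blast
    moreover have "v \<in> {x. (w, x) \<in> E}" using arc_sym[OF adj(2)] by simp
    moreover have "common_neighbours v w \<subseteq> {x. (w, x) \<in> E} - {v}"
      using arc_irrefl[of v] by (auto simp: common_neighbours_iff)
    ultimately show ?thesis unfolding S
      using adj card_common[OF assms] arc_fst_neq[OF adj(2)] finite_neighbours[of w]
      by (simp add: card_Diff_subset finite_subset card_neighbours assms)
  next
    case nonadj
    \<comment> \<open>Distance 3 from v means another point of its fibre, and w has exactly one
      neighbour there, which is not v.\<close>
    have "x \<in> ?S \<longleftrightarrow> (w, x) \<in> E \<and> fst x = fst v" for x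
      using nonadj d(1) d(2)[of x] arc_sym[of w v] arc_fst_neq[of v x]
      by (auto split: if_splits)
    then have S: "?S = {x. (w, x) \<in> E \<and> fst x = fst v}" by blast
    moreover have "fst v \<in> pverts Y" using assms by (auto simp: pverts_cover)
    ultimately show ?thesis unfolding S using nonadj by (simp add: neighbour_in_fibre assms)
  next
    case fibre
    have "x \<notin> ?S" for x using fibre d(1) d(2)[of x] by (auto split: if_splits)
    then have S: "?S = {}" by blast
    show ?thesis unfolding S using fibre by simp
  qed
qed

lemma card_neighbours_closer:
  assumes "v \<in> V" "w \<in> V"
  shows "card {x. (w, x) \<in> E \<and> distance (cover Y r f) v x + 1 = distance (cover Y r f) v w} =
    (if v = w then 0 else if (v, w) \<in> E then 1 else if fst v \<noteq> fst w then m else card (pverts Y) - 1)"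
  (is "card ?S = _")
proof -
  note d = distance_cover[OF assms] distance_cover[OF assms(1) cover_arcD(2)[of w]]
  consider (same) "v = w" | (adj) "v \<noteq> w" "(v, w) \<in> E" | (nonadj) "v \<noteq> w" "(v, w) \<notin> E" "fst v \<noteq> fst w"
    | (fibre) "v \<noteq> w" "(v, w) \<notin> E" "fst v = fst w" by blast
  then show ?thesis
  proof cases
    case same
    have S: "?S = {}" using d unfolding same by auto
    show ?thesis unfolding S using same by simp
  next
    case adj
    have "x \<in> ?S \<longleftrightarrow> x = v" for x
      using adj d(1) d(2)[of x] arc_sym[OF adj(2)] by (auto split: if_splits)
    then have S: "?S = {v}" by blast
    show ?thesis unfolding S using adj by simp
  next
    case nonadj
    have "x \<in> ?S \<longleftrightarrow> x \<in> common_neighbours v w" for x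
      using nonadj d(1) d(2)[of x] arc_sym[of w v] arc_irrefl[of v]
      by (auto simp: common_neighbours_iff split: if_splits)
    then have S: "?S = common_neighbours v w" by blast
    show ?thesis unfolding S using nonadj card_common[OF assms] by simp
  next
    case fibre
    \<comment> \<open>No neighbour of w is adjacent to v, since v and w share a fibre, and none lies
      in that fibre. So all of them are at distance 2 from v.\<close>
    have "x \<in> ?S \<longleftrightarrow> (w, x) \<in> E" for x
      using fibre d(1) d(2)[of x] fibre_neighbour_unique[of v x w] arc_sym[of w x] arc_fst_neq[of w x]
      by (auto split: if_splits)
    then have S: "?S = {x. (w, x) \<in> E}" by blast
    show ?thesis unfolding S using fibre by (simp add: card_neighbours assms)
  qed
qed

lemma distance_regular_cover: "distance_regular (cover Y r f)"
proof -
  \<comment> \<open>With n = \<open>card (pverts Y)\<close> the intersection array is {n-1, n-2-l,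
    1; 1, m, n-1}. Distances never exceed 3, so the values beyond are mere defaults.\<close>
  define b where "b i = (if i = 0 then card (pverts Y) - 1 else if i = 1 then card (pverts Y) - 1 - 1 - l
    else if i = 2 then 1 else (0::nat))" for i :: nat
  define c where "c i = (if i = 0 then 0 else if i = 1 then 1 else if i = 2 then m
    else card (pverts Y) - 1)" for i :: nat
  have "card {x. (w, x) \<in> E \<and> distance (cover Y r f) v x = i + 1} = b i \<and>
      card {x. (w, x) \<in> E \<and> distance (cover Y r f) v x + 1 = i} = c i"
    if "v \<in> V" "w \<in> V" "distance (cover Y r f) v w = i" for v w i
    using card_neighbours_further[OF that(1,2)] card_neighbours_closer[OF that(1,2)]
    unfolding that(3) using distance_cover[OF that(1,2)] that(3) by (simp add: b_def c_def)
  then show ?thesis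
    unfolding distance_regular_def using cover_graph conn by blast
qed

section \<open>Diameter, antipodal classes and the antipodal quotient\<close>

lemma diam_cover: "diam (cover Y r f) = 3"
proof -
  let ?D = "{distance (cover Y r f) v w | v w. v \<in> V \<and> w \<in> V}"
  have "?D \<subseteq> {..3}" using distance_cover by auto
  moreover have "3 \<in> ?D"
  proof -
    obtain u where u: "(u, 1) \<in> V" "(u, 2) \<in> V" by (rule same_fibre_pair)
    then have "distance (cover Y r f) (u, 1) (u, 2) = 3"
      using distance_cover[OF u] arc_fst_neq by fastforce
    with u show ?thesis by force
  qed
  ultimately show ?thesis
    unfolding diam_def by (intro Max_eqI finite_subset[OF _ finite_atMost]) blast+
qed

text \<open>Distance 3, the diameter, occurs exactly between distinct points of one fibre, so the
  antipodal classes are the fibres.\<close>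

lemma antipodal_rel_cover: "antipodal_rel (cover Y r f) = {(x, y). x \<in> V \<and> y \<in> V \<and> fst x = fst y}"
  using distance_cover arc_fst_neq by (fastforce simp: antipodal_rel_def diam_cover split: if_splits)

lemma antipodal_cover: "antipodal (cover Y r f)"
  unfolding antipodal_def antipodal_rel_cover
  by (auto intro!: equivI refl_onI symI transI)

definition fibre :: "'v \<Rightarrow> ('v \<times> nat) set" where
  "fibre u = {u} \<times> {1..r}"

lemma fst_fibre: "fst ` fibre u = {u}"
  using index_ge_2 by (auto simp: fibre_def)

lemma fibre_inject: "fibre u = fibre v \<longleftrightarrow> u = v"
  by (metis fst_fibre singleton_inject)

lemma antipodal_class: "x \<in> V \<Longrightarrow> antipodal_rel (cover Y r f) `` {x} = fibre (fst x)"
  by (auto simp: antipodal_rel_cover fibre_def pverts_cover)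

lemma antipodal_quotient_cover:
  "antipodal_quotient (cover Y r f) =
    \<lparr> pverts = fibre ` pverts Y,
      parcs = {(P, Q). P \<in> fibre ` pverts Y \<and> Q \<in> fibre ` pverts Y \<and> P \<noteq> Q} \<rparr>"
proof -
  have "V // antipodal_rel (cover Y r f) = (\<lambda>x. fibre (fst x)) ` V"
    by (auto simp: quotient_def antipodal_class)
  also have "\<dots> = fibre ` pverts Y"
    using index_ge_2 by (force simp: pverts_cover image_iff)
  finally have classes: "V // antipodal_rel (cover Y r f) = fibre ` pverts Y" .
  have joined: "\<exists>x\<in>fibre u. \<exists>y\<in>fibre v. (x, y) \<in> E"
    if "u \<in> pverts Y" "v \<in> pverts Y" "u \<noteq> v" for u v
  proof (intro bexI)
    show "((u, 1), (v, voltage u v 1)) \<in> E" using that index_ge_2 by (simp add: arc_iff)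
    from cover_arcD[OF this] show "(u, 1) \<in> fibre u" "(v, voltage u v 1) \<in> fibre v"
      by (auto simp: fibre_def pverts_cover)
  qed
  have "\<exists>x\<in>P. \<exists>y\<in>Q. (x, y) \<in> E"
    if PQ: "P \<in> fibre ` pverts Y" "Q \<in> fibre ` pverts Y" "P \<noteq> Q" for P Q
  proof -
    obtain u v where "P = fibre u" "u \<in> pverts Y" "Q = fibre v" "v \<in> pverts Y"
      using PQ(1,2) by blast
    with PQ(3) joined[of u v] show ?thesis by blast
  qed
  then show ?thesis by (simp add: antipodal_quotient_def classes cong: conj_cong)
qed

lemma complete_antipodal_quotient:
  "complete_digraph (card (pverts Y)) (with_proj (antipodal_quotient (cover Y r f)))"
  unfolding complete_digraph_pair_def antipodal_quotient_cover
  by (auto simp: finite_base card_image inj_on_def fibre_inject)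

text \<open>The quotient is \<open>Y\<close> with each vertex renamed to its fibre. Transporting
  \<open>f\<close> along this renaming gives the arc function, and renaming first coordinates gives
  the isomorphism.\<close>

lemma is_cover_via_antipodal_quotient:
  "is_cover_via (\<lambda>x. antipodal_rel (cover Y r f) `` {x}) (cover Y r f) (antipodal_quotient (cover Y r f))"
proof -
  define Z where "Z = antipodal_quotient (cover Y r f)"
  \<comment> \<open>The inverse of \<open>fibre\<close>; it is well defined because fibres are
    nonempty.\<close>
  define base where "base P = the_elem (fst ` P)" for P :: "('v \<times> nat) set"
  have base: "base (fibre u) = u" for u by (simp add: base_def fst_fibre)
  define g where "g P Q = f (base P) (base Q)" for P Q
  define \<phi> where "\<phi> = (\<lambda>(u, j :: nat). (fibre u, j))"
  define h where "h = \<lparr> iso_verts = \<phi>, iso_arcs = map_prod \<phi> \<phi>, iso_head = snd, iso_tail = fst \<rparr>"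
  have inj: "inj \<phi>" by (auto simp: inj_def \<phi>_def fibre_inject prod_eq_iff)
  have quotient: "pverts Z = fibre ` pverts Y"
    "(fibre u, fibre v) \<in> parcs Z \<longleftrightarrow> (u, v) \<in> parcs Y" for u v
    by (auto simp: Z_def antipodal_quotient_cover complete fibre_inject)
  have "symmetric_arc_function Z r G g"
    using arc_function unfolding symmetric_arc_function_def by (simp add: quotient g_def base)
  moreover have "pre_digraph.digraph_isomorphism (with_proj (cover Y r f)) h"
    unfolding pre_digraph.digraph_isomorphism_def
  proof (intro conjI ballI)
    show "wf_digraph (with_proj (cover Y r f))"
      using cover_arcD by unfold_locales auto
    show "inj_on (iso_verts h) (verts (with_proj (cover Y r f)))"
      using inj by (auto simp: h_def intro: inj_on_subset)
    show "inj_on (iso_arcs h) (arcs (with_proj (cover Y r f)))"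
      using prod.inj_map[OF inj inj] by (auto simp: h_def intro: inj_on_subset)
  qed (auto simp: h_def)
  moreover have "with_proj (cover Z r g) = app_iso h (with_proj (cover Y r f))"
  proof -
    have "pverts (cover Z r g) = \<phi> ` V"
      unfolding \<phi>_def pverts_cover image_paired_Times by (simp add: cover_def[of Z] quotient)
    moreover have "parcs (cover Z r g) = map_prod \<phi> \<phi> ` E"
    proof (intro equalityI subsetI)
      fix e assume "e \<in> parcs (cover Z r g)"
      then obtain P j Q k s where e: "e = ((P, j), (Q, k))" "(P, Q) \<in> parcs Z"
          "j \<in> {1..r}" "k \<in> {1..r}" "g Q P = Some s" "s j = k"
        by (auto simp: cover_def[of Z])
      then obtain u v where uv: "P = fibre u" "Q = fibre v"
        by (auto simp: Z_def antipodal_quotient_cover)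
      then have "((u, j), (v, k)) \<in> E"
        using e by (auto simp: cover_def[of Y] quotient(2) g_def base)
      then show "e \<in> map_prod \<phi> \<phi> ` E"
        using e uv by (force simp: \<phi>_def)
    next
      fix e assume "e \<in> map_prod \<phi> \<phi> ` E"
      then show "e \<in> parcs (cover Z r g)"
        by (auto simp: cover_def[of Z] cover_def[of Y] quotient(2) g_def base \<phi>_def)
    qed
    ultimately show ?thesis by (simp add: with_proj_def app_iso_def h_def)
  qed
  moreover have "fst (iso_verts h x) = antipodal_rel (cover Y r f) `` {x}" if "x \<in> V" for x
    using that by (simp add: h_def \<phi>_def antipodal_class split_def)
  moreover have "pair_graph Z"
    using complete_antipodal_quotient unfolding Z_def by (rule pair_graphI_complete)
  moreover have "Digraph_Component.connected (with_proj Z)"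
    using base_nonempty by (intro connected_complete) (auto simp: Z_def antipodal_quotient_cover)
  ultimately show ?thesis unfolding is_cover_via_def Z_def[symmetric] by blast
qed

lemma drackn_cover: "drackn (card (pverts Y)) (cover Y r f)"
  unfolding drackn_def
  using distance_regular_cover antipodal_cover complete_antipodal_quotient
    is_cover_via_antipodal_quotient by blast

end

theorem theorem6p2:
  fixes Y :: "'v pair_pre_digraph"
    and n r :: nat
    and G :: "(nat \<Rightarrow> nat) set"
    and f :: "'v \<Rightarrow> 'v \<Rightarrow> (nat \<Rightarrow> nat) option"
  assumes "complete_digraph n (with_proj Y)"
    and "symmetric_arc_function Y r G f"
    and "normalized Y f"
    and "acts_regularly (arc_group Y r f) r"
    and "cyclic_group (arc_group Y r f)"
    and "Digraph_Component.connected (with_proj (cover Y r f))"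
    and "two_ev_cover Y r f"
  shows "drackn n (cover Y r f)"
proof -
  have n: "card (pverts Y) = n"
    and arcs: "parcs Y = {(u, v). (u, v) \<in> pverts Y \<times> pverts Y \<and> u \<noteq> v}"
    using assms(1) unfolding complete_digraph_pair_def by blast+
  interpret complete_cover Y r G f
  proof (intro complete_cover.intro graph_cover.intro complete_cover_axioms.intro)
    show "pair_graph Y" using assms(1) by (rule pair_graphI_complete)
    show "parcs Y = {(u, v). u \<in> pverts Y \<and> v \<in> pverts Y \<and> u \<noteq> v}"
      unfolding arcs by simp
  qed (rule assms(2))
  obtain l m where lm: "2 \<le> r"
    "\<And>x y. x \<in> V \<Longrightarrow> y \<in> V \<Longrightarrow> fst x \<noteq> fst y \<Longrightarrow>
      card (common_neighbours x y) = (if (x, y) \<in> E then l else m)"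
    using card_common_neighbours[OF assms(7)] by blast
  interpret regular_complete_cover Y r G f l m
    using complete_cover_axioms assms(6) lm
    by (intro regular_complete_cover.intro regular_complete_cover_axioms.intro)
  show ?thesis using drackn_cover by (simp add: n)
qed

end
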